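(* Let $(G,u)$ be a unital Abelian $\ell$-group, let $\mathcal{B}$ be a Boolean algebra, and let $\mu:\mathcal{B}\to G$ be positive, finitely additive on disjoint joins, strictly positive, normalized by $\mu(1)=u$, and interval divisible. For every $n\ge2$ and $x_1,\ldots,x_n\in\Gamma(G,u)$, every bracketing of $x_1\star\cdots\star x_n$ equals the set of attainable values $$\left\{\mu\left(\bigwedge_{i=1}^n a_i\right):a_i\in\mathcal{B},\ \mu(a_i)=x_i\ (1\le i\le n)\right\}=\left[\left(\sum_{i=1}^n x_i-(n-1)u\right)\vee0,\ \bigwedge_{i=1}^n x_i\right]_G.$$
   Context: A unital Abelian $\ell$-group $(G,u)$ is an Abelian lattice-ordered group $G$ with a strong order unit $u$. $\Gamma(G,u)=\{g\in G:0\le g\le u\}$ and $[r,s]_G=\{g\in G:r\le g\le s\}$. For $\mu:\mathcal{B}\to G$: positive means $\mu(a)\ge0$ for all $a$; finitely additive means $\mu(a\vee b)=\mu(a)+\mu(b)$ whenever $a\wedge b=0$; strictly positive means $\mu(a)=0$ implies $a=0$; interval divisible means that whenever $g\in G$ and $0\le g\le\mu(a)$ there is $b\le a$ in $\mathcal{B}$ with $\mu(b)=g$. For $x,y\in\Gamma(G,u)$, $x\star y:=\{\mu(a\wedge b):a,b\in\mathcal{B},\ \mu(a)=x,\ \mu(b)=y\}\subseteq\Gamma(G,u)$. The operation is extended to nonempty subsets of $\Gamma(G,u)$ by $A\star B:=\bigcup_{a\in A,\,b\in B}(a\star b)$, with an element $z$ identified with $\{z\}$. On $G$, $\wedge,\vee$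 denote the lattice operations; on $\mathcal{B}$, the Boolean operations. *)

theory Defs
  imports Main "HOL-Library.Lattice_Algebras"
begin

definition nat_multiple :: "nat \<Rightarrow> 'g::comm_monoid_add \<Rightarrow> 'g" where
  "nat_multiple n g = (\<Sum>_\<in>{..<n}. g)"

definition strong_order_unit :: "'g::lattice_ab_group_add \<Rightarrow> bool" where
  "strong_order_unit u \<longleftrightarrow> 0 \<le> u \<and> (\<forall>g. \<exists>n. g \<le> nat_multiple n u)"

definition unit_interval :: "'g::lattice_ab_group_add \<Rightarrow> 'g set" where
  "unit_interval u = {0..u}"

definition positive :: "('b::boolean_algebra \<Rightarrow> 'g::lattice_ab_group_add) \<Rightarrow> bool" where
  "positive \<mu> \<longleftrightarrow> (\<forall>a. 0 \<le> \<mu> a)"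

definition finitely_additive :: "('b::boolean_algebra \<Rightarrow> 'g::lattice_ab_group_add) \<Rightarrow> bool" where
  "finitely_additive \<mu> \<longleftrightarrow> (\<forall>a b. inf a b = bot \<longrightarrow> \<mu> (sup a b) = \<mu> a + \<mu> b)"

definition strictly_positive :: "('b::boolean_algebra \<Rightarrow> 'g::lattice_ab_group_add) \<Rightarrow> bool" where
  "strictly_positive \<mu> \<longleftrightarrow> (\<forall>a. \<mu> a = 0 \<longrightarrow> a = bot)"

definition interval_divisible :: "('b::boolean_algebra \<Rightarrow> 'g::lattice_ab_group_add) \<Rightarrow> bool" where
  "interval_divisible \<mu> \<longleftrightarrow>
     (\<forall>a g. 0 \<le> g \<and> g \<le> \<mu> a \<longrightarrow> (\<exists>b. b \<le> a \<and> \<mu> b = g))"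

definition star :: "('b::boolean_algebra \<Rightarrow> 'g::lattice_ab_group_add) \<Rightarrow> 'g \<Rightarrow> 'g \<Rightarrow> 'g set" where
  "star \<mu> x y = {\<mu> (inf a b) | a b. \<mu> a = x \<and> \<mu> b = y}"

definition star_set ::
  "('b::boolean_algebra \<Rightarrow> 'g::lattice_ab_group_add) \<Rightarrow> 'g set \<Rightarrow> 'g set \<Rightarrow> 'g set" where
  "star_set \<mu> A B = (\<Union>a\<in>A. \<Union>b\<in>B. star \<mu> a b)"

text \<open>A bracketing of \<open>x\<^sub>1 \<star> \<dots> \<star> x\<^sub>n\<close> is a full binary tree whose leaves,
  read from left to right, are \<open>x\<^sub>1, \<dots>, x\<^sub>n\<close>.\<close>

datatype 'a bracketing = Leaf 'a | Node "'a bracketing" "'a bracketing"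

fun leaves :: "'a bracketing \<Rightarrow> 'a list" where
  "leaves (Leaf x) = [x]"
| "leaves (Node l r) = leaves l @ leaves r"

fun star_value ::
  "('b::boolean_algebra \<Rightarrow> 'g::lattice_ab_group_add) \<Rightarrow> 'g bracketing \<Rightarrow> 'g set" where
  "star_value \<mu> (Leaf x) = {x}"
| "star_value \<mu> (Node l r) = star_set \<mu> (star_value \<mu> l) (star_value \<mu> r)"

definition attainable_values ::
  "('b::boolean_algebra \<Rightarrow> 'g::lattice_ab_group_add) \<Rightarrow> nat \<Rightarrow> (nat \<Rightarrow> 'g) \<Rightarrow> 'g set" where
  "attainable_values \<mu> n x =
     {\<mu> (Inf_fin (a ` {1..n})) | a. \<forall>i\<in>{1..n}. \<mu> (a i) = x i}"

end

(* The complements u - x of the factors add up under star: star of two subintervals of [0,u] is an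
   interval again, with lower bound governed by the sum of the complements, and a value z in it is
   realised by the values sup l z and sup m z (l, m the lower ends of the factors). For the
   attainable values the same computation applies, because the second factor can be chosen
   relative to an already fixed first one: put mass z inside a and the remaining y - z inside - a. *)

theory Submission
  imports Defs
begin

text \<open>The unit is written \<open>\<mu> top\<close> throughout, so that
  \<open>\<mu> top - \<mu> a\<close> is the measure of \<open>- a\<close>.\<close>

locale divisible_measure =
  fixes \<mu> :: "'b::boolean_algebra \<Rightarrow> 'g::lattice_ab_group_add"
  assumes pos: "positive \<mu>"
    and additive: "finitely_additive \<mu>"
    and divisible: "interval_divisible \<mu>"
begin

section \<open>Measures of complements and of meets\<close>

lemma measure_nonneg: "0 \<le> \<mu> a"
  using pos by (simp add: positive_def)

lemma measure_sup: "inf a b = bot \<Longrightarrow> \<mu> (sup a b) = \<mu> a + \<mu> b"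
  using additive by (simp add: finitely_additive_def)

lemma measure_split: "\<mu> a = \<mu> (inf a b) + \<mu> (inf a (- b))"
proof -
  have "inf (inf a b) (inf a (- b)) = bot"
    by (metis inf_compl_bot_right inf_left_commute inf.assoc)
  moreover have "sup (inf a b) (inf a (- b)) = a"
    by (metis inf_sup_distrib1 sup_compl_top inf_top_right)
  ultimately show ?thesis
    using measure_sup by metis
qed

lemma measure_mono: "a \<le> b \<Longrightarrow> \<mu> a \<le> \<mu> b"
  using measure_split[of b a] measure_nonneg[of "inf b (- a)"] by (simp add: inf.absorb2)

lemma measure_compl: "\<mu> (- a) = \<mu> top - \<mu> a"
  using measure_split[of top a] by simp

lemma ex_measure_below:
  assumes "0 \<le> g" "g \<le> \<mu> a"
  obtains b where "b \<le> a" "\<mu> b = g"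
  using divisible assms unfolding interval_divisible_def by blast

text \<open>The lower bound on \<open>z\<close> says exactly that the mass \<open>y - z\<close> fits
  into \<open>- a\<close>. Since \<open>a\<close> is prescribed, the lemma can extend a family of
  elements one member at a time.\<close>

lemma ex_measure_inf:
  assumes lower: "0 \<le> z" "\<mu> a + y - \<mu> top \<le> z" and upper: "z \<le> \<mu> a" "z \<le> y"
  obtains b where "\<mu> b = y" "\<mu> (inf a b) = z"
proof -
  obtain c where c: "c \<le> a" "\<mu> c = z"
    using ex_measure_below lower upper by blast
  have "0 \<le> y - z" "y - z \<le> \<mu> (- a)"
    using lower upper by (simp_all add: measure_compl algebra_simps)
  then obtain d where d: "d \<le> - a" "\<mu> d = y - z"
    using ex_measure_below by blast
  have ad: "inf a d = bot"
    using d(1) by (metis inf_compl_bot inf_mono bot.extremum_uniqueI order_refl)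
  then have "inf c d = bot"
    using c(1) by (metis inf_mono bot.extremum_uniqueI order_refl)
  then have "\<mu> (sup c d) = y"
    using c(2) d(2) by (simp add: measure_sup)
  moreover have "inf a (sup c d) = c"
    using c(1) ad by (simp add: inf_sup_distrib1 inf.absorb2)
  ultimately show ?thesis
    using that c(2) by metis
qed

text \<open>The Frechet lower bound: the part of \<open>a\<close> outside \<open>b\<close> has at
  most the measure of \<open>- b\<close>.\<close>

lemma measure_inf_bounds:
  "\<mu> (inf a b) \<in> {sup (\<mu> a + \<mu> b - \<mu> top) 0 .. inf (\<mu> a) (\<mu> b)}"
proof -
  have "\<mu> (inf a (- b)) \<le> \<mu> top - \<mu> b"
    using measure_mono[of "inf a (- b)" "- b"] by (simp add: measure_compl)
  then have "\<mu> a + \<mu> b - \<mu> top \<le> \<mu> (inf a b)"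
    using measure_split[of a b] by (simp add: algebra_simps)
  then show ?thesis
    by (simp add: measure_nonneg measure_mono)
qed

section \<open>Products of elements and of intervals\<close>

lemma star_eq_interval:
  assumes "x \<in> {0..\<mu> top}"
  shows "star \<mu> x y = {sup (x + y - \<mu> top) 0 .. inf x y}"
proof
  show "star \<mu> x y \<subseteq> {sup (x + y - \<mu> top) 0 .. inf x y}"
    unfolding star_def using measure_inf_bounds by blast
  show "{sup (x + y - \<mu> top) 0 .. inf x y} \<subseteq> star \<mu> x y"
  proof
    fix z assume z: "z \<in> {sup (x + y - \<mu> top) 0 .. inf x y}"
    \<comment> \<open>Any \<open>a\<close> of measure \<open>x\<close> will do, as
      \<open>ex_measure_inf\<close> finds a partner for each prescribed first element.\<close>
    obtain a where a: "\<mu> a = x"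
      using ex_measure_below[of x top] assms by auto
    obtain b where "\<mu> b = y" "\<mu> (inf a b) = z"
      using ex_measure_inf[of z a y] z a by auto
    then show "z \<in> star \<mu> x y"
      unfolding star_def using a by blast
  qed
qed

text \<open>The product is a union of intervals whose ends are monotone in \<open>x\<close> and
  \<open>y\<close>. To reach \<open>z\<close>, both factors must lie above \<open>z\<close> while
  their sum stays at most \<open>z + \<mu> top\<close>; the best choice is therefore the least
  element above \<open>z\<close> in each interval.\<close>

lemma star_set_intervals:
  assumes "0 \<le> l" "l \<le> h" "h \<le> \<mu> top" "0 \<le> m" "m \<le> k" "k \<le> \<mu> top"
  shows "star_set \<mu> {l..h} {m..k} = {sup (l + m - \<mu> top) 0 .. inf h k}"
proof -
  have star: "star \<mu> x y = {sup (x + y - \<mu> top) 0 .. inf x y}" if "x \<in> {l..h}" for x y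
    using that assms by (intro star_eq_interval) auto
  show ?thesis
  proof
    show "star_set \<mu> {l..h} {m..k} \<subseteq> {sup (l + m - \<mu> top) 0 .. inf h k}"
    proof
      fix z assume "z \<in> star_set \<mu> {l..h} {m..k}"
      then obtain x y where xy: "x \<in> {l..h}" "y \<in> {m..k}" and z: "z \<in> star \<mu> x y"
        unfolding star_set_def by blast
      have "l + m \<le> x + y"
        using xy by (simp add: add_mono)
      then have "l + m - \<mu> top \<le> x + y - \<mu> top"
        by (rule diff_right_mono)
      then show "z \<in> {sup (l + m - \<mu> top) 0 .. inf h k}"
        using xy z unfolding star[OF xy(1)]
        by (auto intro: order_trans[of "l + m - \<mu> top" "x + y - \<mu> top"] order_trans)
    qed
    show "{sup (l + m - \<mu> top) 0 .. inf h k} \<subseteq> star_set \<mu> {l..h} {m..k}"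
    proof
      fix z assume z: "z \<in> {sup (l + m - \<mu> top) 0 .. inf h k}"
      have zu: "z \<le> \<mu> top" "l \<le> \<mu> top" "m \<le> \<mu> top"
        using z assms by (auto intro: order_trans)
      \<comment> \<open>The left side is the supremum of \<open>l + m\<close>, \<open>l + z\<close>,
        \<open>z + m\<close> and \<open>z + z\<close>. The first is bounded by the lower end assumed
        for \<open>z\<close>, the others because \<open>l\<close>, \<open>m\<close> and
        \<open>z\<close> lie below \<open>\<mu> top\<close>.\<close>
      have "sup l z + sup m z \<le> z + \<mu> top"
        using z zu add_mono[of z z z "\<mu> top"]
        by (auto simp: add_sup_distrib_left add_sup_distrib_right diff_le_eq add.commute
            add_left_mono)
      then have "z \<in> star \<mu> (sup l z) (sup m z)"
        using z assms star[of "sup l z" "sup m z"] by (simp add: diff_le_eq)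
      moreover have "sup l z \<in> {l..h}" "sup m z \<in> {m..k}"
        using z assms by auto
      ultimately show "z \<in> star_set \<mu> {l..h} {m..k}"
        unfolding star_set_def by blast
    qed
  qed
qed

section \<open>Intervals of lists, with lower ends written through complements so that concatenation
  adds them\<close>

definition star_interval :: "'g list \<Rightarrow> 'g set" where
  "star_interval xs = {sup (\<mu> top - (\<Sum>x\<leftarrow>xs. \<mu> top - x)) 0 .. Inf_fin (set xs)}"

lemma sum_list_compl_nonneg:
  "set xs \<subseteq> {0..\<mu> top} \<Longrightarrow> 0 \<le> (\<Sum>x\<leftarrow>xs. \<mu> top - x)"
  by (intro sum_list_nonneg) auto

lemma compl_le_sum_list:
  assumes "set xs \<subseteq> {0..\<mu> top}" "y \<in> set xs"
  shows "\<mu> top - y \<le> (\<Sum>x\<leftarrow>xs. \<mu> top - x)"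
  using assms
proof (induction xs)
  case (Cons a xs)
  then have "0 \<le> (\<Sum>x\<leftarrow>xs. \<mu> top - x)" "0 \<le> \<mu> top - a"
    by (auto intro!: sum_list_compl_nonneg)
  moreover have "y = a \<or> \<mu> top - y \<le> (\<Sum>x\<leftarrow>xs. \<mu> top - x)"
    using Cons by auto
  ultimately show ?case
    unfolding list.map sum_list.Cons by (blast intro: add_increasing add_increasing2 order_refl)
qed simp

text \<open>Supplies the order hypotheses of \<open>star_set_intervals\<close>. The lower end is
  below each entry \<open>y\<close> because \<open>\<mu> top - y\<close> is one of the nonnegative
  summands.\<close>

lemma star_interval_bounds:
  assumes "set xs \<subseteq> {0..\<mu> top}" "xs \<noteq> []"
  shows "sup (\<mu> top - (\<Sum>x\<leftarrow>xs. \<mu> top - x)) 0 \<le> Inf_fin (set xs)"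
    and "Inf_fin (set xs) \<le> \<mu> top"
proof -
  have "sup (\<mu> top - (\<Sum>x\<leftarrow>xs. \<mu> top - x)) 0 \<le> y" if "y \<in> set xs" for y
    using compl_le_sum_list[OF assms(1) that] assms(1) that by (auto simp: algebra_simps)
  then show "sup (\<mu> top - (\<Sum>x\<leftarrow>xs. \<mu> top - x)) 0 \<le> Inf_fin (set xs)"
    using assms(2) by (intro Inf_fin.boundedI) auto
  have "hd xs \<in> set xs"
    using assms(2) by simp
  then show "Inf_fin (set xs) \<le> \<mu> top"
    using assms(1) by (intro Inf_fin.coboundedI[THEN order_trans]) auto
qed

lemma star_set_star_interval:
  assumes xs: "set xs \<subseteq> {0..\<mu> top}" "xs \<noteq> []" and ys: "set ys \<subseteq> {0..\<mu> top}" "ys \<noteq> []"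
  shows "star_set \<mu> (star_interval xs) (star_interval ys) = star_interval (xs @ ys)"
proof -
  define d where "d = (\<Sum>x\<leftarrow>xs. \<mu> top - x)"
  define e where "e = (\<Sum>y\<leftarrow>ys. \<mu> top - y)"
  have "0 \<le> d" "0 \<le> e"
    using sum_list_compl_nonneg xs ys by (simp_all add: d_def e_def)
  \<comment> \<open>Truncating each factor at 0 first changes nothing: besides
    \<open>\<mu> top - (d + e)\<close>, expanding the suprema only yields \<open>- d\<close>,
    \<open>- e\<close> and \<open>- \<mu> top\<close>, which the outer \<open>sup\<close> with 0
    absorbs.\<close>
  have "sup (sup (\<mu> top - d) 0 + sup (\<mu> top - e) 0 - \<mu> top) 0 = sup (\<mu> top - (d + e)) 0"
  proof (rule order_antisym)
    show "sup (sup (\<mu> top - d) 0 + sup (\<mu> top - e) 0 - \<mu> top) 0 \<le> sup (\<mu> top - (d + e)) 0"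
      using \<open>0 \<le> d\<close> \<open>0 \<le> e\<close> measure_nonneg[of top]
      by (auto simp: add_sup_distrib_left add_sup_distrib_right algebra_simps
          intro: le_supI1 le_supI2 add_increasing)
    have "(\<mu> top - d) + (\<mu> top - e) - \<mu> top
        \<le> sup (\<mu> top - d) 0 + sup (\<mu> top - e) 0 - \<mu> top"
      by (intro diff_right_mono add_mono) simp_all
    moreover have "(\<mu> top - d) + (\<mu> top - e) - \<mu> top = \<mu> top - (d + e)"
      by simp
    ultimately show "sup (\<mu> top - (d + e)) 0 \<le> sup (sup (\<mu> top - d) 0 + sup (\<mu> top - e) 0 - \<mu> top) 0"
      by (metis order_refl sup.mono)
  qed
  moreover have "Inf_fin (set (xs @ ys)) = inf (Inf_fin (set xs)) (Inf_fin (set ys))"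
    using xs ys by (simp add: Inf_fin.union)
  ultimately show ?thesis
    unfolding star_interval_def
    using star_interval_bounds[OF xs] star_interval_bounds[OF ys]
    by (subst star_set_intervals) (auto simp: d_def e_def)
qed

section \<open>Bracketings and attainable values as intervals of lists\<close>

lemma star_interval_singleton: "x \<in> {0..\<mu> top} \<Longrightarrow> star_interval [x] = {x}"
  by (auto simp: star_interval_def sup.absorb1)

lemma leaves_neq_Nil: "leaves t \<noteq> []"
  by (induction t) auto

text \<open>Here the bracketing disappears: a node multiplies two list intervals, which gives the
  interval of the concatenated leaves.\<close>

lemma star_value_eq_star_interval:
  "set (leaves t) \<subseteq> {0..\<mu> top} \<Longrightarrow> star_value \<mu> t = star_interval (leaves t)"
  by (induction t) (simp_all add: star_interval_singleton star_set_star_interval leaves_neq_Nil)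

lemma attainable_values_Suc:
  assumes "1 \<le> n" "x (Suc n) \<in> {0..\<mu> top}"
  shows "attainable_values \<mu> (Suc n) x = star_set \<mu> (attainable_values \<mu> n x) {x (Suc n)}"
proof -
  \<comment> \<open>The bound \<open>1 \<le> n\<close> keeps \<open>{1..n}\<close> nonempty, as the
    insertion rule for \<open>Inf_fin\<close> requires.\<close>
  have Inf: "Inf_fin (a ` {1..Suc n}) = inf (Inf_fin (a ` {1..n})) (a (Suc n))"
    for a :: "nat \<Rightarrow> 'b"
    using assms(1) by (simp add: atLeastAtMostSuc_conv Inf_fin.insert inf.commute)
  show ?thesis
  proof
    show "attainable_values \<mu> (Suc n) x \<subseteq> star_set \<mu> (attainable_values \<mu> n x) {x (Suc n)}"
    proof
      fix z assume "z \<in> attainable_values \<mu> (Suc n) x"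
      then obtain a where a: "\<forall>i\<in>{1..Suc n}. \<mu> (a i) = x i"
        and z: "z = \<mu> (Inf_fin (a ` {1..Suc n}))"
        unfolding attainable_values_def by blast
      have "\<mu> (Inf_fin (a ` {1..n})) \<in> attainable_values \<mu> n x"
        unfolding attainable_values_def using a by auto
      moreover have "z \<in> star \<mu> (\<mu> (Inf_fin (a ` {1..n}))) (x (Suc n))"
        unfolding star_def z Inf using a by force
      ultimately show "z \<in> star_set \<mu> (attainable_values \<mu> n x) {x (Suc n)}"
        unfolding star_set_def by blast
    qed
    show "star_set \<mu> (attainable_values \<mu> n x) {x (Suc n)} \<subseteq> attainable_values \<mu> (Suc n) x"
    proof
      fix z assume "z \<in> star_set \<mu> (attainable_values \<mu> n x) {x (Suc n)}"
      then obtain a where a: "\<forall>i\<in>{1..n}. \<mu> (a i) = x i"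
        and z: "z \<in> star \<mu> (\<mu> (Inf_fin (a ` {1..n}))) (x (Suc n))"
        unfolding star_set_def attainable_values_def by blast
      let ?c = "Inf_fin (a ` {1..n})"
      have "\<mu> ?c \<in> {0..\<mu> top}"
        by (simp add: measure_nonneg measure_mono)
      \<comment> \<open>Membership in \<open>star\<close> only provides some pair with the right
        measures, possibly unrelated to \<open>a\<close>. Passing through the interval bounds gives
        a partner \<open>b\<close> for the meet \<open>?c\<close> already built.\<close>
      then obtain b where b: "\<mu> b = x (Suc n)" "\<mu> (inf ?c b) = z"
        using z ex_measure_inf[of z ?c "x (Suc n)"] by (auto simp: star_eq_interval)
      have "Inf_fin ((a(Suc n := b)) ` {1..Suc n}) = inf ?c b"
        unfolding Inf by simp
      moreover have "\<forall>i\<in>{1..Suc n}. \<mu> ((a(Suc n := b)) i) = x i"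
        using a b(1) by auto
      ultimately show "z \<in> attainable_values \<mu> (Suc n) x"
        unfolding attainable_values_def using b(2) by (smt (verit) mem_Collect_eq)
    qed
  qed
qed

lemma attainable_values_eq_star_interval:
  assumes "1 \<le> n" "\<forall>i\<in>{1..n}. x i \<in> {0..\<mu> top}"
  shows "attainable_values \<mu> n x = star_interval (map x [1..<Suc n])"
  using assms
proof (induction n rule: nat_induct_at_least)
  case base
  \<comment> \<open>Divisibility below \<open>top\<close> ensures that the value \<open>x 1\<close>
    is attained at all.\<close>
  then obtain a where "\<mu> a = x 1"
    using ex_measure_below[of "x 1" top] by auto
  then have "attainable_values \<mu> 1 x = {x 1}"
    by (auto simp: attainable_values_def intro: exI[of _ "\<lambda>_. a"])
  then show ?case
    using base by (simp add: star_interval_singleton)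
next
  case (Suc n)
  have "star_set \<mu> (star_interval (map x [1..<Suc n])) (star_interval [x (Suc n)])
      = star_interval (map x [1..<Suc n] @ [x (Suc n)])"
    using Suc by (intro star_set_star_interval) auto
  then show ?case
    using Suc by (simp add: attainable_values_Suc star_interval_singleton)
qed

text \<open>Among the \<open>n\<close> complements \<open>\<mu> top\<close> is subtracted
  \<open>n\<close> times and the leading \<open>\<mu> top\<close> cancels one of them;
  \<open>1 \<le> n\<close> makes the natural number \<open>n - 1\<close> the true
  difference.\<close>

lemma star_interval_map_upt:
  assumes "1 \<le> n"
  shows "star_interval (map x [1..<Suc n]) =
    {sup ((\<Sum>i\<in>{1..n}. x i) - nat_multiple (n - 1) (\<mu> top)) 0 .. Inf_fin (x ` {1..n})}"
proof -
  have "nat_multiple m g + g = nat_multiple (Suc m) g" for m and g :: 'g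
    by (simp add: nat_multiple_def add.commute)
  from this[of "n - 1"] have mult: "nat_multiple (n - 1) (\<mu> top) + \<mu> top = nat_multiple n (\<mu> top)"
    using assms by simp
  have "(\<Sum>y\<leftarrow>map x [1..<Suc n]. \<mu> top - y) = (\<Sum>i\<in>{1..n}. \<mu> top - x i)"
    by (simp only: map_map comp_def interv_sum_list_conv_sum_set_nat set_upt atLeastLessThanSuc_atLeastAtMost)
  also have "\<dots> = (\<Sum>i\<in>{1..n}. \<mu> top) - (\<Sum>i\<in>{1..n}. x i)"
    by (rule sum_subtractf)
  \<comment> \<open>\<open>nat_multiple\<close> sums over \<open>{..<n}\<close>, hence the index
    shift by \<open>Suc\<close>.\<close>
  also have "(\<Sum>i\<in>{1..n}. \<mu> top) = nat_multiple n (\<mu> top)"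
    unfolding nat_multiple_def by (intro sum.reindex_bij_witness[of _ Suc "\<lambda>i. i - 1"]) auto
  finally have "\<mu> top - (\<Sum>y\<leftarrow>map x [1..<Suc n]. \<mu> top - y)
      = (\<Sum>i\<in>{1..n}. x i) - nat_multiple (n - 1) (\<mu> top)"
    using mult by (simp add: algebra_simps)
  then show ?thesis
    by (simp only: star_interval_def set_map set_upt atLeastLessThanSuc_atLeastAtMost)
qed

end

text \<open>Every bracketing and the set of attainable values equal the interval of the same list
  \<open>map x [1..<Suc n]\<close>, whose closed form is then read off.\<close>

theorem corollary6:
  fixes u :: "'g::lattice_ab_group_add"
    and \<mu> :: "'b::boolean_algebra \<Rightarrow> 'g"
    and n :: nat
    and x :: "nat \<Rightarrow> 'g"
  assumes "strong_order_unit u"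
    and "positive \<mu>"
    and "finitely_additive \<mu>"
    and "strictly_positive \<mu>"
    and "\<mu> top = u"
    and "interval_divisible \<mu>"
    and "2 \<le> n"
    and "\<forall>i\<in>{1..n}. x i \<in> unit_interval u"
  shows "(\<forall>t. leaves t = map x [1..<Suc n] \<longrightarrow> star_value \<mu> t = attainable_values \<mu> n x) \<and>
         attainable_values \<mu> n x =
           {sup ((\<Sum>i\<in>{1..n}. x i) - nat_multiple (n - 1) u) 0 .. Inf_fin (x ` {1..n})}"
proof -
  interpret divisible_measure \<mu>
    using assms by unfold_locales
  have x: "\<forall>i\<in>{1..n}. x i \<in> {0..\<mu> top}"
    using assms by (simp add: unit_interval_def)
  then have "star_value \<mu> t = star_interval (map x [1..<Suc n])"
    if "leaves t = map x [1..<Suc n]" for t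
    using that by (subst star_value_eq_star_interval) auto
  moreover have "attainable_values \<mu> n x = star_interval (map x [1..<Suc n])"
    using x assms(7) by (intro attainable_values_eq_star_interval) auto
  ultimately show ?thesis
    using star_interval_map_upt[of n x] assms(5,7) by simp
qed

end
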